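(* Let $\{u^k\}_{k\ge 0}$ be any sequence generated by the HPGCG algorithm described in the context, and let $r(u) := (f+g)(u)-\inf_H (f+g)$. Then $\{r(u^k)\}_k$ is monotonically non-increasing and converges to zero with rate $o(k^{-1/3})$, i.e. $\lim_{k\to\infty} k^{1/3}\, r(u^k) = 0$.
   Context: Setting. $H$ is a (real) Hilbert space. $f:H\to\mathbb{R}$ is convex and Fréchet differentiable with Lipschitz continuous gradient $\nabla f$. $g:H\to\mathbb{R}\cup\{\infty\}$ is proper, convex and lower semicontinuous. $f+g$ is coercive, i.e. $(f+g)(u)\to\infty$ as $\|u\|\to\infty$. The problem $\min_{u\in H} f(u)+g(u)$ then admits an optimal solution. $P:H\to H$ is a bounded, linear, self-adjoint, positive semidefinite operator; write $\langle u,v\rangle_P := \langle u,Pv\rangle$ and $\|u\|_P^2 := \langle u,Pu\rangle$. It is assumed that $F:=\tfrac12\|\cdot\|_P^2+g$ is strongly coercive, i.e. $F(u)/\|u\|\to\infty$ as $\|u\|\to\infty$. For $u\in H$ put $H_u(v):=\langle\nabla f(u),v\rangle-\langle u,v\rangle_P+\tfrac12\|v\|_P^2+g(v)$ for $v\in H$. Let $v(u)$ denote any minimizer of $H_u$ over $H$ (one exists by strong coercivity), and let $D(u):=H_u(u)-\inf_{v\in H} H_u(v)$. Fix a function $D_f:H\times H\to\mathbb{R}$ such that: (i) $D_f(u,v)\ge f(v)-f(u)-\langle\nabla f(u),v-u\rangle$ for all $u,v\in H$; (ii) $D_f(u,u+\theta(v-u))\le\theta^2 D_f(u,v)$ for all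 $u,v\in H$ and $\theta\in[0,1]$; (iii) $D_f$ is bounded on bounded sets. HPGCG algorithm. Choose $u^0\in\operatorname{Dom}(g)=\{u\in H: g(u)<\infty\}$. For $k=0,1,2,\dots$: let $v^k=v(u^k)$ be a minimizer of $H_{u^k}$; set $\theta_k=\min\left(1,\frac{D(u^k)+\frac12\|u^k-v^k\|_P^2}{2D_f(u^k,v^k)}\right)$, with $\theta_k:=1$ if $D_f(u^k,v^k)=0$; and set $u^{k+1}=u^k+\theta_k(v^k-u^k)$. *)

theory Defs
  imports "HOL-Analysis.Analysis"
begin

text \<open>Functions \<open>H \<rightarrow> \<real> \<union> {\<infinity>}\<close> are modelled as \<^typ>\<open>ereal\<close>-valued functions;
  properness excludes the value \<open>-\<infinity>\<close>.\<close>

definition proper :: "('a \<Rightarrow> ereal) \<Rightarrow> bool" where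
  "proper g \<longleftrightarrow> (\<forall>u. g u \<noteq> -\<infinity>) \<and> (\<exists>u. g u < \<infinity>)"

definition effective_domain :: "('a \<Rightarrow> ereal) \<Rightarrow> 'a set" where
  "effective_domain g = {u. g u < \<infinity>}"

text \<open>At the end points \<open>t = 0\<close> and \<open>t = 1\<close> the inequality is trivial, because \<open>0 * \<infinity> = 0\<close>
  in \<^typ>\<open>ereal\<close>.\<close>

definition ereal_convex :: "('a::real_vector \<Rightarrow> ereal) \<Rightarrow> bool" where
  "ereal_convex g \<longleftrightarrow>
     (\<forall>u v. \<forall>t\<in>{0..1}. g ((1 - t) *\<^sub>R u + t *\<^sub>R v) \<le> ereal (1 - t) * g u + ereal t * g v)"

definition lower_semicontinuous :: "('a::topological_space \<Rightarrow> ereal) \<Rightarrow> bool" where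
  "lower_semicontinuous g \<longleftrightarrow> (\<forall>u. g u \<le> Liminf (at u) g)"

definition coercive :: "('a::real_normed_vector \<Rightarrow> ereal) \<Rightarrow> bool" where
  "coercive F \<longleftrightarrow> (F \<longlongrightarrow> \<infinity>) at_infinity"

definition strongly_coercive :: "('a::real_normed_vector \<Rightarrow> ereal) \<Rightarrow> bool" where
  "strongly_coercive F \<longleftrightarrow> ((\<lambda>u. F u / ereal (norm u)) \<longlongrightarrow> \<infinity>) at_infinity"

definition self_adjoint :: "('a::real_inner \<Rightarrow> 'a) \<Rightarrow> bool" where
  "self_adjoint P \<longleftrightarrow> (\<forall>u v. P u \<bullet> v = u \<bullet> P v)"

definition positive_semidefinite :: "('a::real_inner \<Rightarrow> 'a) \<Rightarrow> bool" where
  "positive_semidefinite P \<longleftrightarrow> (\<forall>u. 0 \<le> u \<bullet> P u)"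

definition inner_wrt :: "('a::real_inner \<Rightarrow> 'a) \<Rightarrow> 'a \<Rightarrow> 'a \<Rightarrow> real" where
  "inner_wrt P u v = u \<bullet> P v"

definition norm_sq_wrt :: "('a::real_inner \<Rightarrow> 'a) \<Rightarrow> 'a \<Rightarrow> real" where
  "norm_sq_wrt P u = u \<bullet> P u"

definition objective :: "('a \<Rightarrow> real) \<Rightarrow> ('a \<Rightarrow> ereal) \<Rightarrow> 'a \<Rightarrow> ereal" where
  "objective f g u = ereal (f u) + g u"

definition residual :: "('a \<Rightarrow> real) \<Rightarrow> ('a \<Rightarrow> ereal) \<Rightarrow> 'a \<Rightarrow> ereal" where
  "residual f g u = objective f g u - (INF w. objective f g w)"

text \<open>In the following definitions \<open>df\<close> is the gradient map of \<open>f\<close>.\<close>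

definition subproblem ::
  "('a::real_inner \<Rightarrow> 'a) \<Rightarrow> ('a \<Rightarrow> ereal) \<Rightarrow> ('a \<Rightarrow> 'a) \<Rightarrow> 'a \<Rightarrow> 'a \<Rightarrow> ereal" where
  "subproblem df g P u v =
     ereal (df u \<bullet> v - inner_wrt P u v + 1/2 * norm_sq_wrt P v) + g v"

definition gap :: "('a::real_inner \<Rightarrow> 'a) \<Rightarrow> ('a \<Rightarrow> ereal) \<Rightarrow> ('a \<Rightarrow> 'a) \<Rightarrow> 'a \<Rightarrow> ereal" where
  "gap df g P u = subproblem df g P u u - (INF v. subproblem df g P u v)"

text \<open>The minimum is taken in \<^typ>\<open>ereal\<close>, where it is at most \<open>1\<close>; the quotient is nonnegative
  whenever \<open>Df\<close> majorizes the Bregman distance of a convex \<open>f\<close>, so the conversion to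
  \<^typ>\<open>real\<close> loses nothing.\<close>

definition step_size ::
  "('a::real_inner \<Rightarrow> 'a) \<Rightarrow> ('a \<Rightarrow> ereal) \<Rightarrow> ('a \<Rightarrow> 'a) \<Rightarrow> ('a \<Rightarrow> 'a \<Rightarrow> real) \<Rightarrow> 'a \<Rightarrow> 'a \<Rightarrow> real" where
  "step_size df g P Df u v =
     (if Df u v = 0 then 1
      else real_of_ereal
        (min 1 ((gap df g P u + ereal (1/2 * norm_sq_wrt P (u - v))) / ereal (2 * Df u v))))"

definition hpgcg_sequence ::
  "('a::real_inner \<Rightarrow> 'a) \<Rightarrow> ('a \<Rightarrow> ereal) \<Rightarrow> ('a \<Rightarrow> 'a) \<Rightarrow> ('a \<Rightarrow> 'a \<Rightarrow> real)
     \<Rightarrow> (nat \<Rightarrow> 'a) \<Rightarrow> bool" where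
  "hpgcg_sequence df g P Df u \<longleftrightarrow>
     u 0 \<in> effective_domain g \<and>
     (\<exists>v. \<forall>k. is_arg_min (subproblem df g P (u k)) (\<lambda>_. True) (v k) \<and>
              u (Suc k) = u k + step_size df g P Df (u k) (v k) *\<^sub>R (v k - u k))"

end

theory Submission
  imports Defs
begin

text \<open>
  Write \<open>\<Phi> = f + g\<close>, \<open>r\<^sub>k = \<Phi> (u k) - inf \<Phi>\<close>, \<open>q x = \<langle>x, x\<rangle>\<^sub>P\<close> and
  \<open>a\<^sub>k = D (u k) + q (u k - v k) / 2\<close>; in the gap the quadratic terms cancel, so that
  \<open>a\<^sub>k = df (u k) \<bullet> (u k - v k) + g (u k) - g (v k)\<close>, as in the Frank--Wolfe method. Two facts carry the proof.

  The first is descent. The step size minimizes the upper model \<open>\<Phi> (u k) - \<theta> a\<^sub>k + \<theta>\<^sup>2 Df (u k) (v k)\<close>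
  of the objective over \<open>\<theta> \<in> [0, 1]\<close>, so
  \<open>\<Phi> (u (k+1)) \<le> \<Phi> (u k) - \<theta>\<^sub>k a\<^sub>k / 2\<close> (lemma \<open>descent\<close>). In particular \<open>\<Sum> \<theta>\<^sub>k a\<^sub>k < \<infinity>\<close>.

  The second is the variational inequality for the minimizer \<open>v k\<close> of the subproblem
  (lemma \<open>residual_bound\<close>):
  \<open>\<Phi> (u k) - \<Phi> w \<le> a\<^sub>k + \<langle>v k - u k, w - v k\<rangle>\<^sub>P\<close> for every \<open>w\<close>. It is used twice. Since
  \<open>q (v k - u k) \<le> a\<^sub>k\<close> and all the points involved are bounded, the inequality of arithmetic and
  geometric means turns it into \<open>r\<^sub>k\<^sup>2 \<le> const * a\<^sub>k\<close>, and hence into \<open>\<theta>\<^sub>k \<ge> const * r\<^sub>k\<^sup>2\<close>. On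
  the other hand it makes \<open>q (u k - w)\<close> an almost Fejer monotone quantity: it grows by at most
  \<open>2 \<theta>\<^sub>k (a\<^sub>k - (\<Phi> (u k) - \<Phi> w))\<close> in a step, and telescoping gives
  \<open>\<Sum> \<theta>\<^sub>k r\<^sub>k < \<infinity>\<close>. Descent and the first use alone would give \<open>r\<^sub>k - r\<^bsub>k+1\<^esub> \<ge> const * r\<^sub>k\<^sup>4\<close>, which
  yields only \<open>O(k\<^sup>-\<^sup>1\<^sup>/\<^sup>3)\<close>; the two uses combine to \<open>\<Sum> r\<^sub>k\<^sup>3 < \<infinity>\<close>, and a nonincreasing
  summable sequence is \<open>o(1/k)\<close>.

  The comparison points \<open>w\<close> run through a minimizing sequence. It can be kept in the sublevel set
  of \<open>u 0\<close>, which is bounded by coercivity, so all the constants are uniform along it.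
\<close>

section \<open>Sequences and convex functions\<close>

text \<open>The second half of the first \<open>n\<close> terms of the series contains about \<open>n/2\<close> terms, each at
  least \<open>x n\<close>, and its sum tends to zero by Cauchy's criterion.\<close>

lemma decseq_summable_imp_smallo_inverse:
  fixes x :: "nat \<Rightarrow> real"
  assumes "decseq x" and nonneg: "\<And>n. 0 \<le> x n" and "summable x"
  shows "(\<lambda>n. real n * x n) \<longlonglongrightarrow> 0"
proof (rule tendsto_sandwich[where f = "\<lambda>_. 0"])
  define S where "S n = (\<Sum>k<n. x k)" for n
  have S: "S \<longlonglongrightarrow> suminf x"
    unfolding S_def by (rule summable_LIMSEQ[OF assms(3)])
  have half: "filterlim (\<lambda>n::nat. n div 2) sequentially sequentially"
    unfolding filterlim_at_top
  proof
    fix Z :: nat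
    show "eventually (\<lambda>n. Z \<le> n div 2) sequentially"
      using eventually_ge_at_top[of "2 * Z"] by eventually_elim auto
  qed
  have "(\<lambda>n. S (n div 2)) \<longlonglongrightarrow> suminf x"
    using filterlim_compose[OF S half] by simp
  then show "(\<lambda>n. 2 * (S n - S (n div 2))) \<longlonglongrightarrow> 0"
    using tendsto_mult[OF tendsto_const[of 2] tendsto_diff[OF S]] by fastforce
  have "real n * x n \<le> 2 * (S n - S (n div 2))" for n
  proof -
    have "(\<Sum>k\<in>{n div 2..<n}. x n) \<le> (\<Sum>k\<in>{n div 2..<n}. x k)"
      using \<open>decseq x\<close> by (intro sum_mono) (auto simp: decseq_def)
    also have "\<dots> = S n - S (n div 2)"
      unfolding S_def lessThan_atLeast0 by (rule sum_diff_nat_ivl[symmetric]) auto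
    finally have 1: "real (n - n div 2) * x n \<le> S n - S (n div 2)"
      by simp
    have "real n \<le> 2 * real (n - n div 2)"
      by linarith
    then have "real n * x n \<le> 2 * real (n - n div 2) * x n"
      using nonneg by (rule mult_right_mono)
    also have "\<dots> \<le> 2 * (S n - S (n div 2))"
      using 1 by (simp only: mult.assoc mult_le_cancel_left_pos zero_less_numeral)
    finally show ?thesis .
  qed
  then show "eventually (\<lambda>n. real n * x n \<le> 2 * (S n - S (n div 2))) sequentially"
    by simp
  show "eventually (\<lambda>n. 0 \<le> real n * x n) sequentially"
    using nonneg by simp
qed auto

lemma decseq_summable_cube_imp_smallo:
  fixes r :: "nat \<Rightarrow> real"
  assumes "decseq r" and nonneg: "\<And>n. 0 \<le> r n" and "summable (\<lambda>n. r n ^ 3)"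
  shows "(\<lambda>n. real n powr (1/3) * r n) \<longlonglongrightarrow> 0"
proof -
  have "(\<lambda>n. real n * r n ^ 3) \<longlonglongrightarrow> 0"
    using assms by (intro decseq_summable_imp_smallo_inverse)
      (auto simp: decseq_def intro!: power_mono)
  then have "(\<lambda>n. root 3 (real n * r n ^ 3)) \<longlonglongrightarrow> root 3 0"
    by (rule tendsto_real_root)
  moreover have "root 3 (real n * r n ^ 3) = real n powr (1/3) * r n" for n
  proof -
    have "root 3 (real n * r n ^ 3) = root 3 (real n) * r n"
      using nonneg[of n] by (simp add: real_root_mult real_root_power_cancel)
    also have "root 3 (real n) = real n powr (1/3)"
      by (cases "n = 0") (auto simp: root_powr_inverse)
    finally show ?thesis .
  qed
  ultimately show ?thesis by simp
qed

lemma first_order_coefficient_nonneg: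
  fixes A B :: real
  assumes "\<And>t. 0 < t \<Longrightarrow> t \<le> 1 \<Longrightarrow> 0 \<le> t * A + t\<^sup>2 * B"
  shows "0 \<le> A"
proof (rule ccontr)
  assume "\<not> 0 \<le> A"
  then have A: "A < 0" by simp
  define t where "t = - A / (2 * (\<bar>A\<bar> + \<bar>B\<bar>))"
  have t: "0 < t" "t \<le> 1"
    using A by (auto simp: t_def field_simps)
  have "2 * (t * (\<bar>A\<bar> + \<bar>B\<bar>)) = - A"
    using A by (simp add: t_def field_simps)
  moreover have "t * B \<le> t * (\<bar>A\<bar> + \<bar>B\<bar>)"
    using t by (intro mult_left_mono) auto
  ultimately have "A + t * B < 0"
    using A by linarith
  then have "t * (A + t * B) < 0"
    using t by (simp add: mult_pos_neg)
  with assms[OF t] show False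
    by (simp add: power2_eq_square algebra_simps)
qed

text \<open>Along the segment from \<open>x\<close> to \<open>y\<close> this is the tangent inequality of a convex function of one
  real variable.\<close>

lemma convex_above_gradient:
  fixes f :: "'a::real_inner \<Rightarrow> real"
  assumes "convex_on UNIV f" and "GDERIV f x :> d"
  shows "f x + d \<bullet> (y - x) \<le> f y"
proof -
  define \<phi> where "\<phi> t = f (x + t *\<^sub>R (y - x))" for t
  have conv: "convex_on UNIV \<phi>"
  proof (rule convex_onI)
    fix t s s' :: real
    assume t: "0 < t" "t < 1"
    have *: "x + ((1 - t) * s + t * s') *\<^sub>R (y - x)
        = (1 - t) *\<^sub>R (x + s *\<^sub>R (y - x)) + t *\<^sub>R (x + s' *\<^sub>R (y - x))"
      by (simp add: algebra_simps)
    show "\<phi> ((1 - t) *\<^sub>R s + t *\<^sub>R s') \<le> (1 - t) * \<phi> s + t * \<phi> s'"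
      unfolding \<phi>_def real_scaleR_def *
      using convex_onD[OF assms(1), of t] t by simp
  qed simp
  have "(f has_derivative (\<lambda>h. h \<bullet> d)) (at (x + 0 *\<^sub>R (y - x)))"
    using assms(2) by (simp add: gderiv_def)
  moreover have "((\<lambda>t::real. x + t *\<^sub>R (y - x)) has_derivative (\<lambda>t. t *\<^sub>R (y - x))) (at 0)"
    by (auto intro!: derivative_eq_intros)
  ultimately have "(\<phi> has_derivative (\<lambda>t. (t *\<^sub>R (y - x)) \<bullet> d)) (at 0)"
    unfolding \<phi>_def using has_derivative_compose by blast
  then have "(\<phi> has_field_derivative ((y - x) \<bullet> d)) (at 0)"
    unfolding has_field_derivative_def by (rule has_derivative_eq_rhs) (auto simp: mult.commute)
  then have "\<phi> 1 - \<phi> 0 \<ge> ((y - x) \<bullet> d) * (1 - 0)"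
    using convex_on_imp_above_tangent[OF conv, of 0 1] by simp
  then show ?thesis
    by (simp add: \<phi>_def inner_commute)
qed

section \<open>The semi-inner product of a positive semidefinite operator\<close>

lemma norm_sq_wrt_add_scaled:
  assumes "bounded_linear P" and "self_adjoint P"
  shows "norm_sq_wrt P (x + t *\<^sub>R y) = norm_sq_wrt P x + 2 * t * (y \<bullet> P x) + t\<^sup>2 * norm_sq_wrt P y"
proof -
  interpret bounded_linear P by fact
  have "x \<bullet> P y = y \<bullet> P x"
    using assms(2) by (metis self_adjoint_def inner_commute)
  then show ?thesis
    by (simp add: norm_sq_wrt_def add scaleR algebra_simps power2_eq_square)
qed

text \<open>The weighted form of the inequality of arithmetic and geometric means; the weight \<open>t\<close> is
  free for the application to optimize.\<close>

lemma inner_wrt_le_weighted: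
  assumes "bounded_linear P" and "self_adjoint P" and "positive_semidefinite P" and "0 < t"
  shows "x \<bullet> P y \<le> t / 2 * norm_sq_wrt P x + norm_sq_wrt P y / (2 * t)"
proof -
  have "0 \<le> norm_sq_wrt P (y + (- t) *\<^sub>R x)"
    using assms(3) by (simp add: norm_sq_wrt_def positive_semidefinite_def)
  then have "2 * t * (x \<bullet> P y) \<le> norm_sq_wrt P y + t\<^sup>2 * norm_sq_wrt P x"
    by (subst (asm) norm_sq_wrt_add_scaled[OF assms(1,2)]) simp
  then show ?thesis
    using \<open>0 < t\<close> by (simp add: field_simps power2_eq_square)
qed

section \<open>The iteration on the effective domain\<close>

text \<open>On the effective domain \<open>S\<close> the nonsmooth term is a real function \<open>G\<close>, and only points of \<open>S\<close>
  occur in the algorithm. Coercivity and strong coercivity are stated in the form of the bounds that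
  they give on \<open>S\<close>. The formula for the step size is asked for only when \<open>u k\<close> lies in \<open>S\<close>, since
  the gap is infinite otherwise; that all iterates do lie in \<open>S\<close> is then proved by induction.\<close>

locale hpgcg_iteration =
  fixes f :: "'a::real_inner \<Rightarrow> real" and df :: "'a \<Rightarrow> 'a"
    and G :: "'a \<Rightarrow> real" and S :: "'a set"
    and P :: "'a \<Rightarrow> 'a" and Df :: "'a \<Rightarrow> 'a \<Rightarrow> real"
    and u v :: "nat \<Rightarrow> 'a" and \<theta> :: "nat \<Rightarrow> real"
  assumes above_gradient: "f x + df x \<bullet> (y - x) \<le> f y"
    and majorant: "f y - f x - df x \<bullet> (y - x) \<le> Df x y"
    and Df_scaling: "t \<in> {0..1} \<Longrightarrow> Df x (x + t *\<^sub>R (y - x)) \<le> t\<^sup>2 * Df x y"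
    and G_convex: "convex_on S G"
    and P_linear: "bounded_linear P" and P_self_adjoint: "self_adjoint P"
    and P_psd: "positive_semidefinite P"
    and sublevel_bounded: "bounded {w \<in> S. f w + G w \<le> c}"
    and strong: "\<exists>R. \<forall>x\<in>S. R \<le> norm x \<longrightarrow> M * norm x \<le> 1/2 * norm_sq_wrt P x + G x"
    and df_bounded: "bounded A \<Longrightarrow> bounded (df ` A)"
    and Df_bounded: "bounded B \<Longrightarrow> bounded ((\<lambda>(x, y). Df x y) ` B)"
    and u_0: "u 0 \<in> S" and v_in: "v k \<in> S"
    and v_min: "w \<in> S \<Longrightarrow>
      df (u k) \<bullet> v k - u k \<bullet> P (v k) + 1/2 * norm_sq_wrt P (v k) + G (v k)
      \<le> df (u k) \<bullet> w - u k \<bullet> P w + 1/2 * norm_sq_wrt P w + G w"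
    and step: "u k \<in> S \<Longrightarrow> \<theta> k = (if Df (u k) (v k) = 0 then 1
      else min 1 ((df (u k) \<bullet> (u k - v k) + G (u k) - G (v k)) / (2 * Df (u k) (v k))))"
    and u_Suc: "u (Suc k) = u k + \<theta> k *\<^sub>R (v k - u k)"
begin

definition obj :: "'a \<Rightarrow> real" where
  "obj x = f x + G x"

definition fw_gap :: "nat \<Rightarrow> real" where
  "fw_gap k = df (u k) \<bullet> (u k - v k) + G (u k) - G (v k)"

definition obj_inf :: real where
  "obj_inf = Inf (obj ` S)"

lemma P_add_scaled: "norm_sq_wrt P (x + t *\<^sub>R y) = norm_sq_wrt P x + 2 * t * (y \<bullet> P x) + t\<^sup>2 * norm_sq_wrt P y"
  by (rule norm_sq_wrt_add_scaled[OF P_linear P_self_adjoint])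

lemma norm_sq_wrt_nonneg: "0 \<le> norm_sq_wrt P x"
  using P_psd by (simp add: norm_sq_wrt_def positive_semidefinite_def)

lemma Df_nonneg: "0 \<le> Df x y"
  using majorant[of y x] above_gradient[of x y] by simp

lemma segment_in_S:
  assumes "x \<in> S" "y \<in> S" "t \<in> {0..1}"
  shows "x + t *\<^sub>R (y - x) \<in> S" "G (x + t *\<^sub>R (y - x)) \<le> (1 - t) * G x + t * G y"
proof -
  have *: "x + t *\<^sub>R (y - x) = (1 - t) *\<^sub>R x + t *\<^sub>R y"
    by (simp add: algebra_simps)
  show "x + t *\<^sub>R (y - x) \<in> S"
    unfolding * using convex_on_imp_convex[OF G_convex] assms by (auto simp: convex_def)
  show "G (x + t *\<^sub>R (y - x)) \<le> (1 - t) * G x + t * G y"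
    unfolding * using convex_onD[OF G_convex, of t x y] assms by auto
qed

text \<open>The first-order optimality condition of the subproblem: compare \<open>v k\<close> with the points
  \<open>v k + t (w - v k)\<close>, bound \<open>G\<close> on the segment by convexity and let \<open>t\<close> tend to zero.\<close>

lemma variational_inequality:
  assumes "w \<in> S"
  shows "0 \<le> df (u k) \<bullet> (w - v k) + (v k - u k) \<bullet> P (w - v k) + G w - G (v k)"
proof (rule first_order_coefficient_nonneg[where B = "1/2 * norm_sq_wrt P (w - v k)"])
  fix t :: real
  assume t: "0 < t" "t \<le> 1"
  interpret bounded_linear P by (rule P_linear)
  define z where "z = v k + t *\<^sub>R (w - v k)"
  have z: "z \<in> S" "G z \<le> (1 - t) * G (v k) + t * G w"
    unfolding z_def using segment_in_S[OF v_in assms, of t] t by auto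
  have Pz: "norm_sq_wrt P z
      = norm_sq_wrt P (v k) + 2 * t * (v k \<bullet> P (w - v k)) + t\<^sup>2 * norm_sq_wrt P (w - v k)"
    unfolding z_def P_add_scaled
    using P_self_adjoint by (metis self_adjoint_def inner_commute)
  have "df (u k) \<bullet> z = df (u k) \<bullet> v k + t * (df (u k) \<bullet> (w - v k))"
    "u k \<bullet> P z = u k \<bullet> P (v k) + t * (u k \<bullet> P (w - v k))"
    by (simp_all add: z_def add scaleR inner_add_right)
  then have "df (u k) \<bullet> v k - u k \<bullet> P (v k) + 1/2 * norm_sq_wrt P (v k) + G (v k)
      \<le> df (u k) \<bullet> v k + t * (df (u k) \<bullet> (w - v k)) - (u k \<bullet> P (v k) + t * (u k \<bullet> P (w - v k)))
        + 1/2 * (norm_sq_wrt P (v k) + 2 * t * (v k \<bullet> P (w - v k)) + t\<^sup>2 * norm_sq_wrt P (w - v k))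
        + ((1 - t) * G (v k) + t * G w)"
    using v_min[OF z(1), of k] z(2) Pz by simp
  moreover have "t * ((v k - u k) \<bullet> P (w - v k)) = t * (v k \<bullet> P (w - v k)) - t * (u k \<bullet> P (w - v k))"
    by (simp add: inner_diff_left algebra_simps)
  ultimately show "0 \<le> t * (df (u k) \<bullet> (w - v k) + (v k - u k) \<bullet> P (w - v k) + G w - G (v k))
      + t\<^sup>2 * (1/2 * norm_sq_wrt P (w - v k))"
    by (simp add: algebra_simps)
qed

text \<open>Linearize \<open>f\<close> at \<open>u k\<close> and eliminate \<open>G w\<close> by the variational inequality. Along a sequence of
  near-minimizers \<open>w\<close> the left-hand side tends to the residual.\<close>

lemma residual_bound:
  assumes "w \<in> S"
  shows "obj (u k) - obj w \<le> fw_gap k + (v k - u k) \<bullet> P (w - v k)"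
proof -
  have "f (u k) - f w \<le> df (u k) \<bullet> (u k - w)"
    using above_gradient[of "u k" w] by (simp add: inner_diff_right)
  with variational_inequality[OF assms, of k] show ?thesis
    by (simp add: obj_def fw_gap_def inner_diff_right)
qed

lemma proximal_term_le_fw_gap:
  assumes "u k \<in> S"
  shows "norm_sq_wrt P (v k - u k) \<le> fw_gap k"
proof -
  interpret bounded_linear P by (rule P_linear)
  have "P (u k - v k) = - P (v k - u k)"
    by (simp add: diff)
  with variational_inequality[OF assms, of k] show ?thesis
    by (simp add: fw_gap_def norm_sq_wrt_def)
qed

lemma fw_gap_nonneg: "u k \<in> S \<Longrightarrow> 0 \<le> fw_gap k"
  using proximal_term_le_fw_gap norm_sq_wrt_nonneg order_trans by blast

lemma step_range:
  assumes "u k \<in> S"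
  shows "\<theta> k \<in> {0..1}"
  using fw_gap_nonneg[OF assms] Df_nonneg[of "u k" "v k"] by (auto simp: step[OF assms] fw_gap_def)

lemma u_in: "u k \<in> S"
proof (induction k)
  case (Suc k)
  then show ?case
    unfolding u_Suc by (intro segment_in_S v_in step_range)
qed (rule u_0)

section \<open>Descent\<close>

text \<open>The step size is capped so that the quadratic term of the upper model eats up at most half of
  the linear decrease.\<close>

lemma descent: "obj (u (Suc k)) \<le> obj (u k) - \<theta> k * fw_gap k / 2"
proof -
  have \<theta>: "\<theta> k \<in> {0..1}" by (rule step_range[OF u_in])
  have Df0: "0 \<le> Df (u k) (v k)" and a0: "0 \<le> fw_gap k"
    using Df_nonneg fw_gap_nonneg[OF u_in] by auto
  have "\<theta> k * Df (u k) (v k) \<le> fw_gap k / 2"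
  proof (cases "Df (u k) (v k) = 0")
    case False
    then have "\<theta> k \<le> fw_gap k / (2 * Df (u k) (v k))"
      by (simp add: step[OF u_in] fw_gap_def)
    then show ?thesis
      using False Df0 by (simp add: field_simps)
  qed (use a0 in simp)
  then have half: "(\<theta> k)\<^sup>2 * Df (u k) (v k) \<le> \<theta> k * (fw_gap k / 2)"
    using \<theta> by (auto simp: power2_eq_square mult.assoc intro!: mult_left_mono)
  have "f (u (Suc k)) \<le> f (u k) + \<theta> k * (df (u k) \<bullet> (v k - u k)) + (\<theta> k)\<^sup>2 * Df (u k) (v k)"
    using majorant[of "u (Suc k)" "u k"] Df_scaling[OF \<theta>, of "u k" "v k"] by (simp add: u_Suc)
  moreover have "G (u (Suc k)) \<le> (1 - \<theta> k) * G (u k) + \<theta> k * G (v k)"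
    unfolding u_Suc by (rule segment_in_S[OF u_in v_in \<theta>])
  moreover have "df (u k) \<bullet> (v k - u k) = - (df (u k) \<bullet> (u k - v k))"
    by (simp add: inner_diff_right)
  ultimately show ?thesis
    using half by (simp add: obj_def fw_gap_def algebra_simps add_divide_distrib diff_divide_distrib)
qed

lemma decseq_obj: "decseq (\<lambda>k. obj (u k))"
proof (rule decseq_SucI)
  fix k
  have "0 \<le> \<theta> k * fw_gap k"
    using step_range[OF u_in] fw_gap_nonneg[OF u_in] by simp
  with descent[of k] show "obj (u (Suc k)) \<le> obj (u k)" by simp
qed

lemma obj_u_le_initial: "obj (u k) \<le> obj (u 0)"
  using decseq_obj by (auto simp: decseq_def)

section \<open>Boundedness\<close>

abbreviation initial_sublevel :: "'a set" where
  "initial_sublevel \<equiv> {w \<in> S. obj w \<le> obj (u 0)}"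

lemma u_sublevel: "u k \<in> initial_sublevel"
  using u_in obj_u_le_initial by simp

lemma initial_sublevel_bounded: "bounded initial_sublevel"
  using sublevel_bounded[of "obj (u 0)"] by (simp add: obj_def)

lemma range_u_bounded: "bounded (range u)"
  by (rule bounded_subset[OF initial_sublevel_bounded]) (use u_sublevel in auto)

text \<open>Comparing \<open>v k\<close> with \<open>u 0\<close> in the subproblem bounds a function of superlinear growth at \<open>v k\<close>
  by a linear one.\<close>

lemma range_v_bounded: "bounded (range v)"
proof -
  interpret bounded_linear P by (rule P_linear)
  obtain M1 where M1: "\<And>k. norm (df (u k)) \<le> M1"
    using df_bounded[OF range_u_bounded] by (auto simp: bounded_iff)
  obtain M2 where M2: "\<And>k. norm (P (u k)) \<le> M2"
    using bounded_linear_image[OF range_u_bounded P_linear] by (auto simp: bounded_iff)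
  define M where "M = M1 + M2"
  define C where "C = M * norm (u 0) + (1/2 * norm_sq_wrt P (u 0) + G (u 0))"
  obtain R where R: "\<And>x. x \<in> S \<Longrightarrow> R \<le> norm x \<Longrightarrow> (M + 1) * norm x \<le> 1/2 * norm_sq_wrt P x + G x"
    using strong by blast
  have lin: "\<bar>df (u k) \<bullet> x - u k \<bullet> P x\<bar> \<le> M * norm x" for k x
  proof -
    have "df (u k) \<bullet> x - u k \<bullet> P x = (df (u k) - P (u k)) \<bullet> x"
      using P_self_adjoint by (simp add: self_adjoint_def inner_diff_left)
    also have "\<bar>\<dots>\<bar> \<le> norm (df (u k) - P (u k)) * norm x"
      by (rule Cauchy_Schwarz_ineq2)
    also have "\<dots> \<le> M * norm x"
      using norm_triangle_ineq4[of "df (u k)" "P (u k)"] M1[of k] M2[of k]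
      by (intro mult_right_mono) (auto simp: M_def)
    finally show ?thesis .
  qed
  have "norm (v k) \<le> max R C" for k
  proof (cases "R \<le> norm (v k)")
    case True
    have "norm (v k) \<le> C"
      using R[OF v_in True] v_min[OF u_0, of k] lin[of k "v k"] lin[of k "u 0"]
      by (simp add: C_def algebra_simps abs_le_iff)
    then show ?thesis by simp
  qed simp
  then show ?thesis
    by (auto simp: bounded_iff)
qed

lemma Df_iterates_bounded:
  obtains K where "0 < K" "\<And>k. Df (u k) (v k) \<le> K"
proof -
  have "bounded ((\<lambda>(x, y). Df x y) ` (range u \<times> range v))"
    by (intro Df_bounded bounded_Times range_u_bounded range_v_bounded)
  then obtain K where K: "\<And>k. \<bar>Df (u k) (v k)\<bar> \<le> K"
    by (force simp: bounded_iff)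
  then have "0 < max 1 K" "Df (u k) (v k) \<le> max 1 K" for k
    using K[of k] by (auto simp: le_max_iff_disj abs_le_iff)
  then show thesis by (rule that)
qed

lemma norm_sq_wrt_bounded:
  assumes "bounded A"
  shows "\<exists>C. \<forall>x\<in>A. norm_sq_wrt P x \<le> C"
proof -
  obtain B where B: "\<And>x. x \<in> A \<Longrightarrow> norm x \<le> B"
    using assms by (auto simp: bounded_iff)
  obtain B' where B': "\<And>x. x \<in> A \<Longrightarrow> norm (P x) \<le> B'"
    using bounded_linear_image[OF assms P_linear] by (auto simp: bounded_iff)
  have "norm_sq_wrt P x \<le> B * B'" if "x \<in> A" for x
  proof -
    have "norm_sq_wrt P x \<le> norm x * norm (P x)"
      unfolding norm_sq_wrt_def by (rule norm_cauchy_schwarz)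
    also have "\<dots> \<le> B * B'"
      using B[OF that] B'[OF that] by (intro mult_mono) (auto intro: order_trans[OF norm_ge_zero])
    finally show ?thesis .
  qed
  then show ?thesis by blast
qed

text \<open>Only the points \<open>w\<close> of the initial sublevel set are compared with the iterates, so one
  constant serves for all \<open>w\<close> and all \<open>k\<close>.\<close>

lemma sublevel_distance_bounded:
  obtains C where "0 < C"
    "\<And>w k. w \<in> initial_sublevel \<Longrightarrow> norm_sq_wrt P (w - v k) \<le> C"
    "\<And>w k. w \<in> initial_sublevel \<Longrightarrow> norm_sq_wrt P (u k - w) \<le> C"
proof -
  obtain C1 where C1: "\<And>w k. w \<in> initial_sublevel \<Longrightarrow> norm_sq_wrt P (w - v k) \<le> C1"
    using norm_sq_wrt_bounded[OF bounded_minus[OF initial_sublevel_bounded range_v_bounded]] by fast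
  obtain C2 where C2: "\<And>w k. w \<in> initial_sublevel \<Longrightarrow> norm_sq_wrt P (u k - w) \<le> C2"
    using norm_sq_wrt_bounded[OF bounded_minus[OF range_u_bounded initial_sublevel_bounded]] by fast
  show thesis
    by (rule that[of "max 1 (max C1 C2)"]) (use C1 C2 in \<open>auto simp: le_max_iff_disj\<close>)
qed

text \<open>The variational inequality at \<open>v 0\<close> bounds the objective from below on the initial sublevel
  set, where the cross term is bounded; elsewhere \<open>obj (u 0)\<close> is a lower bound.\<close>

lemma obj_bdd_below: "bdd_below (obj ` S)"
proof -
  obtain C where C: "\<And>w k. w \<in> initial_sublevel \<Longrightarrow> norm_sq_wrt P (w - v k) \<le> C"
    using sublevel_distance_bounded by metis
  define b where "b = fw_gap 0 + (1/2 * norm_sq_wrt P (v 0 - u 0) + C / 2)"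
  have b: "obj (u 0) - b \<le> obj w" if "w \<in> initial_sublevel" for w
  proof -
    have "(v 0 - u 0) \<bullet> P (w - v 0) \<le> 1/2 * norm_sq_wrt P (v 0 - u 0) + C / 2"
      using inner_wrt_le_weighted[OF P_linear P_self_adjoint P_psd zero_less_one,
          of "v 0 - u 0" "w - v 0"] C[OF that, of 0] by simp
    with residual_bound[of w 0] that show ?thesis
      by (simp add: b_def)
  qed
  have "obj (u 0) - max 0 b \<le> obj w" if "w \<in> S" for w
    using b[of w] that by (cases "obj w \<le> obj (u 0)") auto
  then show ?thesis
    by (auto simp: bdd_below_def)
qed

lemma obj_inf_le: "w \<in> S \<Longrightarrow> obj_inf \<le> obj w"
  unfolding obj_inf_def by (intro cInf_lower obj_bdd_below imageI)

lemma minimizing_sequence: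
  obtains w where "\<And>n. w n \<in> initial_sublevel" "(\<lambda>n. obj (w n)) \<longlonglongrightarrow> obj_inf"
proof -
  have "\<exists>w. w \<in> initial_sublevel \<and> obj w < obj_inf + inverse (real (Suc n))" for n
  proof -
    have "Inf (obj ` S) < obj_inf + inverse (real (Suc n))"
      by (simp add: obj_inf_def)
    then obtain w where w: "w \<in> S" "obj w < obj_inf + inverse (real (Suc n))"
      using cInf_lessD[of "obj ` S"] u_0 by auto
    show ?thesis
    proof (cases "obj w \<le> obj (u 0)")
      case False
      \<comment> \<open>The point \<open>u 0\<close> is then an even better near-minimizer.\<close>
      then show ?thesis using w u_sublevel[of 0] by (intro exI[of _ "u 0"]) auto
    qed (use w in auto)
  qed
  then obtain w where w: "\<And>n. w n \<in> initial_sublevel"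
      "\<And>n. obj (w n) < obj_inf + inverse (real (Suc n))"
    by metis
  have "(\<lambda>n. obj (w n)) \<longlonglongrightarrow> obj_inf"
  proof (rule tendsto_sandwich[OF _ _ tendsto_const])
    show "(\<lambda>n. obj_inf + inverse (real (Suc n))) \<longlonglongrightarrow> obj_inf"
      by (rule LIMSEQ_inverse_real_of_nat_add)
    show "eventually (\<lambda>n. obj_inf \<le> obj (w n)) sequentially"
      using obj_inf_le w(1) by simp
    show "eventually (\<lambda>n. obj (w n) \<le> obj_inf + inverse (real (Suc n))) sequentially"
      using w(2) by (simp add: less_imp_le)
  qed
  with w(1) show thesis by (rule that)
qed

section \<open>Residual against gap and step size\<close>

definition res :: "nat \<Rightarrow> real" where
  "res k = obj (u k) - obj_inf"

lemma res_nonneg: "0 \<le> res k"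
  using obj_inf_le[OF u_in] by (simp add: res_def)

lemma decseq_res: "decseq res"
  using decseq_obj by (simp add: decseq_def res_def)

text \<open>In the bound for \<open>\<rho> = obj (u k) - obj w\<close> the cross term is split with the weight \<open>C / \<rho>\<close>. Its
  part in \<open>w - v k\<close> is then at most \<open>\<rho> / 2\<close>, which moves to the left, and its part in \<open>v k - u k\<close> is at
  most \<open>C / (2 \<rho>)\<close> times the gap; multiplying by \<open>\<rho>\<close> gives the square.\<close>

lemma res_power2_le_fw_gap:
  obtains E where "0 < E" "\<And>k. (res k)\<^sup>2 \<le> E * fw_gap k"
proof -
  obtain C where C: "0 < C" "\<And>w k. w \<in> initial_sublevel \<Longrightarrow> norm_sq_wrt P (w - v k) \<le> C"
    using sublevel_distance_bounded by metis
  obtain w where w: "\<And>n. w n \<in> initial_sublevel" "(\<lambda>n. obj (w n)) \<longlonglongrightarrow> obj_inf"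
    using minimizing_sequence by blast
  have "(res k)\<^sup>2 \<le> 2 * (res 0 + C) * fw_gap k" for k
  proof (cases "res k = 0")
    case True
    then show ?thesis
      using fw_gap_nonneg[OF u_in] res_nonneg[of 0] C by simp
  next
    case False
    then have pos: "0 < res k"
      using res_nonneg[of k] by simp
    have lim: "(\<lambda>n. obj (u k) - obj (w n)) \<longlonglongrightarrow> res k"
      unfolding res_def by (intro tendsto_diff tendsto_const w(2))
    have "(obj (u k) - obj (w n))\<^sup>2 \<le> 2 * (res 0 + C) * fw_gap k" if "0 < obj (u k) - obj (w n)" for n
    proof -
      define \<rho> where "\<rho> = obj (u k) - obj (w n)"
      have \<rho>: "0 < \<rho>" "\<rho> \<le> res 0"
        using that obj_inf_le[of "w n"] w(1)[of n] obj_u_le_initial[of k] by (auto simp: \<rho>_def res_def)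
      have "\<rho> \<le> fw_gap k + (v k - u k) \<bullet> P (w n - v k)"
        unfolding \<rho>_def using residual_bound w(1) by simp
      also have "(v k - u k) \<bullet> P (w n - v k)
          \<le> (C / \<rho>) / 2 * norm_sq_wrt P (v k - u k) + norm_sq_wrt P (w n - v k) / (2 * (C / \<rho>))"
        using C(1) \<rho> by (intro inner_wrt_le_weighted P_linear P_self_adjoint P_psd) auto
      also have "\<dots> \<le> (C / \<rho>) / 2 * fw_gap k + C / (2 * (C / \<rho>))"
        using C(1) \<rho> C(2)[OF w(1)] proximal_term_le_fw_gap[OF u_in]
        by (intro add_mono mult_left_mono divide_right_mono) auto
      also have "C / (2 * (C / \<rho>)) = \<rho> / 2"
        using C(1) by simp
      finally have "\<rho> / 2 \<le> fw_gap k + (C / \<rho>) / 2 * fw_gap k" by simp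
      then have "\<rho>\<^sup>2 \<le> (2 * \<rho> + C) * fw_gap k"
        using \<rho> by (simp add: field_simps power2_eq_square)
      also have "\<dots> \<le> 2 * (res 0 + C) * fw_gap k"
        using \<rho> C(1) fw_gap_nonneg[OF u_in] by (intro mult_right_mono) auto
      finally show ?thesis unfolding \<rho>_def .
    qed
    then have "eventually (\<lambda>n. (obj (u k) - obj (w n))\<^sup>2 \<le> 2 * (res 0 + C) * fw_gap k) sequentially"
      using order_tendstoD(1)[OF lim pos] by (auto elim: eventually_mono)
    then show ?thesis
      using tendsto_upperbound[OF tendsto_power[OF lim]] by simp
  qed
  moreover have "0 < 2 * (res 0 + C)"
    using C(1) res_nonneg[of 0] by simp
  ultimately show thesis by (rule that[rotated])
qed

lemma step_size_lower_bound:
  obtains c where "0 < c" "\<And>k. c * (res k)\<^sup>2 \<le> \<theta> k"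
proof -
  obtain K where K: "0 < K" "\<And>k. Df (u k) (v k) \<le> K"
    using Df_iterates_bounded by blast
  obtain E where E: "0 < E" "\<And>k. (res k)\<^sup>2 \<le> E * fw_gap k"
    using res_power2_le_fw_gap by blast
  \<comment> \<open>The two summands of \<open>Z\<close> serve the two arguments of the minimum in the step size.\<close>
  define Z where "Z = (res 0)\<^sup>2 + 2 * K * E"
  have "0 < 2 * K * E" using K(1) E(1) by simp
  then have Z: "0 < Z" unfolding Z_def by (intro add_nonneg_pos) auto
  have "1 / Z * (res k)\<^sup>2 \<le> \<theta> k" for k
  proof -
    have "res k \<le> res 0" using decseq_res by (simp add: decseq_def)
    then have "(res k)\<^sup>2 \<le> Z"
      using power_mono[OF _ res_nonneg, of k "res 0" 2] \<open>0 < 2 * K * E\<close> unfolding Z_def by linarith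
    then have one: "1 / Z * (res k)\<^sup>2 \<le> 1"
      using Z by simp
    have "1 / Z * (res k)\<^sup>2 \<le> fw_gap k / (2 * Df (u k) (v k))" if "Df (u k) (v k) \<noteq> 0"
    proof -
      have Df: "0 < Df (u k) (v k)" using that Df_nonneg[of "u k" "v k"] by simp
      have "1 / Z * (res k)\<^sup>2 \<le> 1 / (2 * K * E) * (E * fw_gap k)"
        using E Z \<open>0 < 2 * K * E\<close> by (intro mult_mono divide_left_mono) (auto simp: Z_def)
      also have "\<dots> = fw_gap k / (2 * K)" using E(1) by simp
      also have "\<dots> \<le> fw_gap k / (2 * Df (u k) (v k))"
        using K Df fw_gap_nonneg[OF u_in] by (intro divide_left_mono) auto
      finally show ?thesis .
    qed
    with one show ?thesis by (simp add: step[OF u_in] fw_gap_def)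
  qed
  then show thesis using Z by (intro that[of "1 / Z"]) auto
qed

section \<open>Summability of the cubed residuals\<close>

text \<open>The cross term of the expanded square pairs \<open>v k - u k\<close> with \<open>u k - w\<close>, whereas the variational
  inequality controls the pairing with \<open>v k - w\<close>. The difference is \<open>- norm_sq_wrt P (v k - u k)\<close>; it
  has the good sign and, as \<open>\<theta>\<^sup>2 \<le> 2 \<theta>\<close>, absorbs the quadratic term of the expansion.\<close>

lemma almost_fejer:
  assumes "w \<in> S"
  shows "norm_sq_wrt P (u (Suc k) - w)
    \<le> norm_sq_wrt P (u k - w) + 2 * (\<theta> k * (fw_gap k - (obj (u k) - obj w)))"
proof -
  interpret bounded_linear P by (rule P_linear)
  define Q where "Q = norm_sq_wrt P (v k - u k)"
  have Q: "0 \<le> Q" unfolding Q_def by (rule norm_sq_wrt_nonneg)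
  have \<theta>: "0 \<le> \<theta> k" "\<theta> k \<le> 1" using step_range[OF u_in] by auto
  have "u (Suc k) - w = (u k - w) + \<theta> k *\<^sub>R (v k - u k)"
    by (simp add: u_Suc)
  then have 1: "norm_sq_wrt P (u (Suc k) - w)
      = norm_sq_wrt P (u k - w) + 2 * \<theta> k * ((v k - u k) \<bullet> P (u k - w)) + (\<theta> k)\<^sup>2 * Q"
    by (simp only: P_add_scaled Q_def)
  have "(v k - u k) \<bullet> P (u k - w) = - ((v k - u k) \<bullet> P (w - v k)) - Q"
    by (simp add: Q_def norm_sq_wrt_def diff inner_diff_right)
  then have "(v k - u k) \<bullet> P (u k - w) \<le> fw_gap k - (obj (u k) - obj w) - Q"
    using residual_bound[OF assms, of k] by simp
  then have "2 * \<theta> k * ((v k - u k) \<bullet> P (u k - w))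
      \<le> 2 * \<theta> k * (fw_gap k - (obj (u k) - obj w) - Q)"
    using \<theta> by (intro mult_left_mono) auto
  moreover have "(\<theta> k)\<^sup>2 * Q \<le> 2 * \<theta> k * Q"
    using \<theta> Q by (auto simp: power2_eq_square intro!: mult_right_mono)
  ultimately show ?thesis
    unfolding 1 by (simp add: algebra_simps)
qed

lemma sum_step_fw_gap: "(\<Sum>k<n. \<theta> k * fw_gap k) \<le> 2 * (obj (u 0) - obj (u n))"
proof (induction n)
  case (Suc n)
  then show ?case using descent[of n] by simp
qed simp

lemma sum_step_residual:
  assumes "w \<in> S"
  shows "2 * (\<Sum>k<n. \<theta> k * (obj (u k) - obj w))
    \<le> 2 * (\<Sum>k<n. \<theta> k * fw_gap k) + (norm_sq_wrt P (u 0 - w) - norm_sq_wrt P (u n - w))"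
proof (induction n)
  case (Suc n)
  have "norm_sq_wrt P (u (Suc n) - w)
      \<le> norm_sq_wrt P (u n - w) + 2 * (\<theta> n * fw_gap n - \<theta> n * (obj (u n) - obj w))"
    using almost_fejer[OF assms, of n] by (simp only: right_diff_distrib)
  with Suc show ?case
    unfolding sum.lessThan_Suc distrib_left right_diff_distrib by linarith
qed simp

text \<open>The partial sums for a fixed \<open>w\<close> have a bound that is the same for all \<open>w\<close> in the initial
  sublevel set, so \<open>obj w\<close> may tend to the infimum under the finite sum.\<close>

lemma summable_step_res: "summable (\<lambda>k. \<theta> k * res k)"
proof -
  obtain C where C: "\<And>w k. w \<in> initial_sublevel \<Longrightarrow> norm_sq_wrt P (u k - w) \<le> C"
    using sublevel_distance_bounded by metis
  obtain w where w: "\<And>n. w n \<in> initial_sublevel" "(\<lambda>n. obj (w n)) \<longlonglongrightarrow> obj_inf"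
    using minimizing_sequence by blast
  have bound: "(\<Sum>k<n. \<theta> k * res k) \<le> 2 * res 0 + C / 2" for n
  proof (rule LIMSEQ_le_const2)
    show "(\<lambda>i. \<Sum>k<n. \<theta> k * (obj (u k) - obj (w i))) \<longlonglongrightarrow> (\<Sum>k<n. \<theta> k * res k)"
      unfolding res_def by (intro tendsto_intros w(2))
    have "(\<Sum>k<n. \<theta> k * (obj (u k) - obj (w i))) \<le> 2 * res 0 + C / 2" for i
      using sum_step_residual[of "w i" n] sum_step_fw_gap[of n] w(1)[of i] C[of "w i" 0]
        norm_sq_wrt_nonneg[of "u n - w i"] obj_inf_le[OF u_in, of n]
      by (simp add: res_def)
    then show "\<exists>N. \<forall>i\<ge>N. (\<Sum>k<n. \<theta> k * (obj (u k) - obj (w i))) \<le> 2 * res 0 + C / 2"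
      by blast
  qed
  show ?thesis
    using step_range[OF u_in] res_nonneg by (intro summableI_nonneg_bounded[OF _ bound]) auto
qed

lemma summable_res_cube: "summable (\<lambda>k. res k ^ 3)"
proof -
  obtain c where c: "0 < c" "\<And>k. c * (res k)\<^sup>2 \<le> \<theta> k"
    using step_size_lower_bound by blast
  have "res k ^ 3 \<le> 1 / c * (\<theta> k * res k)" for k
  proof -
    have "c * res k ^ 3 = c * (res k)\<^sup>2 * res k"
      by (simp add: power3_eq_cube power2_eq_square)
    also have "\<dots> \<le> \<theta> k * res k"
      by (rule mult_right_mono[OF c(2) res_nonneg])
    finally show ?thesis using c(1) by (simp add: field_simps)
  qed
  then show ?thesis
    using res_nonneg
    by (intro summable_comparison_test'[OF summable_mult[OF summable_step_res, of "1 / c"], of 0]) auto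
qed

lemma res_rate: "(\<lambda>k. real k powr (1/3) * res k) \<longlonglongrightarrow> 0"
  by (rule decseq_summable_cube_imp_smallo[OF decseq_res res_nonneg summable_res_cube])

lemma res_tendsto_0: "res \<longlonglongrightarrow> 0"
proof (rule tendsto_sandwich[OF _ _ tendsto_const res_rate])
  show "eventually (\<lambda>k. res k \<le> real k powr (1/3) * res k) sequentially"
    using eventually_ge_at_top[of 1]
  proof eventually_elim
    case (elim k)
    then have "1 \<le> real k powr (1/3)" by (simp add: ge_one_powr_ge_zero)
    then show ?case using mult_right_mono[OF _ res_nonneg, of 1 _ k] by simp
  qed
qed (use res_nonneg in simp)

end

section \<open>Extended-valued data\<close>

lemma proper_real_on_domain:
  assumes "proper g" and "w \<in> effective_domain g"
  shows "g w = ereal (real_of_ereal (g w))"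
proof -
  have "g w \<noteq> \<infinity>" "g w \<noteq> -\<infinity>"
    using assms by (auto simp: proper_def effective_domain_def)
  then show ?thesis by (cases "g w") auto
qed

lemma ereal_convex_imp_convex_on_domain:
  assumes "proper g" and "ereal_convex g"
  shows "convex_on (effective_domain g) (\<lambda>x. real_of_ereal (g x))"
proof -
  have le: "g ((1 - t) *\<^sub>R x + t *\<^sub>R y)
      \<le> ereal ((1 - t) * real_of_ereal (g x) + t * real_of_ereal (g y))"
    if "x \<in> effective_domain g" "y \<in> effective_domain g" "0 \<le> t" "t \<le> 1" for x y t
  proof -
    have "g ((1 - t) *\<^sub>R x + t *\<^sub>R y) \<le> ereal (1 - t) * g x + ereal t * g y"
      using assms(2) that by (auto simp: ereal_convex_def)
    also have "\<dots> = ereal ((1 - t) * real_of_ereal (g x) + t * real_of_ereal (g y))"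
      by (subst (1) proper_real_on_domain[OF assms(1) that(1)],
          subst (1) proper_real_on_domain[OF assms(1) that(2)]) simp
    finally show ?thesis .
  qed
  have conv: "convex (effective_domain g)"
    unfolding convex_alt
  proof (intro ballI allI impI)
    fix x y t
    assume "x \<in> effective_domain g" "y \<in> effective_domain g" "0 \<le> t \<and> t \<le> (1::real)"
    then show "(1 - t) *\<^sub>R x + t *\<^sub>R y \<in> effective_domain g"
      using le[of x y t] by (auto simp: effective_domain_def dest: le_less_trans)
  qed
  show ?thesis
  proof (rule convex_onI[OF _ conv])
    fix t :: real and x y
    assume *: "0 < t" "t < 1" "x \<in> effective_domain g" "y \<in> effective_domain g"
    then have "(1 - t) *\<^sub>R x + t *\<^sub>R y \<in> effective_domain g"
      using convexD_alt[OF conv, of x y t] by simp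
    from proper_real_on_domain[OF assms(1) this] le[of x y t] *
    show "real_of_ereal (g ((1 - t) *\<^sub>R x + t *\<^sub>R y))
        \<le> (1 - t) * real_of_ereal (g x) + t * real_of_ereal (g y)"
      by (metis ereal_less_eq(3) less_imp_le)
  qed
qed

lemma coercive_sublevel_bounded:
  assumes "coercive F"
  shows "bounded {x. F x \<le> ereal c}"
proof -
  obtain b where "\<And>x. b \<le> norm x \<Longrightarrow> ereal c < F x"
    using assms unfolding coercive_def tendsto_PInfty eventually_at_infinity by blast
  then have "\<forall>x\<in>{x. F x \<le> ereal c}. norm x \<le> b"
    by (metis linorder_not_le mem_Collect_eq nle_le)
  then show ?thesis
    unfolding bounded_iff by blast
qed

lemma strongly_coercive_above_linear:
  assumes "strongly_coercive F"
  shows "\<exists>R. \<forall>x. R \<le> norm x \<longrightarrow> ereal (M * norm x) \<le> F x"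
proof -
  obtain b where b: "\<And>x. b \<le> norm x \<Longrightarrow> ereal M < F x / ereal (norm x)"
    using assms unfolding strongly_coercive_def tendsto_PInfty eventually_at_infinity by blast
  have "ereal (M * norm x) \<le> F x" if "max b 1 \<le> norm x" for x
  proof -
    have pos: "0 < norm x" and "b \<le> norm x" using that by auto
    then have "ereal M < F x / ereal (norm x)" using b by blast
    with pos show ?thesis
      by (cases "F x") (auto simp: field_simps)
  qed
  then show ?thesis by blast
qed

lemma lipschitz_on_bounded_image:
  fixes h :: "'a::real_normed_vector \<Rightarrow> 'b::metric_space"
  assumes "L-lipschitz_on UNIV h" and "bounded A"
  shows "bounded (h ` A)"
proof -
  obtain B where B: "\<And>x. x \<in> A \<Longrightarrow> dist 0 x \<le> B"
    using assms(2) by (auto simp: bounded_any_center[where a = 0])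
  have "dist (h 0) (h x) \<le> L * B" if "x \<in> A" for x
  proof -
    have "dist (h 0) (h x) \<le> L * dist 0 x"
      by (rule lipschitz_onD[OF assms(1)]) auto
    also have "\<dots> \<le> L * B"
      using B[OF that] lipschitz_on_nonneg[OF assms(1)] by (rule mult_left_mono)
    finally show ?thesis .
  qed
  then show ?thesis
    by (auto simp: bounded_def)
qed

text \<open>Outside the effective domain the objective is infinite, so these points do not affect the
  infimum.\<close>

lemma INF_objective:
  assumes "proper g"
    and "bdd_below ((\<lambda>x. f x + real_of_ereal (g x)) ` effective_domain g)"
  shows "(INF w. objective f g w)
    = ereal (Inf ((\<lambda>x. f x + real_of_ereal (g x)) ` effective_domain g))"
proof -
  let ?S = "effective_domain g" and ?h = "\<lambda>x. f x + real_of_ereal (g x)"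
  have obj: "objective f g w = ereal (?h w)" if "w \<in> ?S" for w
    unfolding objective_def by (subst proper_real_on_domain[OF assms(1) that]) simp
  have "?S \<noteq> {}"
    using assms(1) by (auto simp: proper_def effective_domain_def)
  then have "ereal (Inf (?h ` ?S)) = (INF w\<in>?S. ereal (?h w))"
    using ereal_Inf'[OF assms(2)] by (simp add: image_image)
  also have "\<dots> = (INF w\<in>?S. objective f g w)"
    using obj by simp
  also have "\<dots> = (INF w. objective f g w)"
  proof (rule antisym)
    show "(INF w\<in>?S. objective f g w) \<le> (INF w. objective f g w)"
    proof (rule INF_greatest)
      fix w
      show "(INF w\<in>?S. objective f g w) \<le> objective f g w"
        by (cases "w \<in> ?S") (auto simp: objective_def effective_domain_def intro: INF_lower)
    qed
  qed (simp add: INF_superset_mono)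
  finally show ?thesis by simp
qed

text \<open>Once the infimum is known to be attained at \<open>v\<close>, the quadratic terms of the gap complete the
  square \<open>- norm_sq_wrt P (u - v) / 2\<close>.\<close>

lemma gap_plus_proximal_term:
  assumes "proper g" and "bounded_linear P" and "self_adjoint P"
    and "u \<in> effective_domain g" and "v \<in> effective_domain g"
    and "is_arg_min (subproblem df g P u) (\<lambda>_. True) v"
  shows "gap df g P u + ereal (1/2 * norm_sq_wrt P (u - v))
    = ereal (df u \<bullet> (u - v) + real_of_ereal (g u) - real_of_ereal (g v))"
proof -
  have "(INF w. subproblem df g P u w) = subproblem df g P u v"
    using assms(6) by (intro antisym INF_lower INF_greatest) (auto simp: is_arg_min_linorder)
  moreover have "subproblem df g P u w
      = ereal (df u \<bullet> w - u \<bullet> P w + 1/2 * norm_sq_wrt P w + real_of_ereal (g w))"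
    if "w \<in> effective_domain g" for w
    unfolding subproblem_def inner_wrt_def
    by (subst proper_real_on_domain[OF assms(1) that]) simp
  moreover have "norm_sq_wrt P (u - v) = norm_sq_wrt P u - 2 * (u \<bullet> P v) + norm_sq_wrt P v"
    using norm_sq_wrt_add_scaled[OF assms(2,3), of u "-1" v] assms(3)
    by (simp add: self_adjoint_def inner_commute)
  ultimately show ?thesis
    using assms(4,5) by (simp add: gap_def norm_sq_wrt_def inner_diff_right add_divide_distrib diff_divide_distrib)
qed

lemma step_size_eq:
  assumes "proper g" and "bounded_linear P" and "self_adjoint P"
    and "u \<in> effective_domain g" and "v \<in> effective_domain g"
    and "is_arg_min (subproblem df g P u) (\<lambda>_. True) v"
  shows "step_size df g P Df u v = (if Df u v = 0 then 1
    else min 1 ((df u \<bullet> (u - v) + real_of_ereal (g u) - real_of_ereal (g v)) / (2 * Df u v)))"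
  unfolding step_size_def gap_plus_proximal_term[OF assms]
  by (simp add: min_def flip: one_ereal_def)

text \<open>The subproblem is infinite off the effective domain, and finite on it, so a minimizer lies in
  it.\<close>

lemma minimizer_in_domain:
  assumes "proper g" and "is_arg_min (subproblem df g P x) (\<lambda>_. True) y"
  shows "y \<in> effective_domain g"
proof -
  obtain w where "g w < \<infinity>" using assms(1) by (auto simp: proper_def)
  then have "subproblem df g P x w < \<infinity>" by (simp add: subproblem_def)
  then have "subproblem df g P x y < \<infinity>"
    using assms(2) by (auto simp: is_arg_min_linorder intro: le_less_trans)
  then show ?thesis
    by (auto simp: subproblem_def effective_domain_def)
qed

theorem theorem1:
  fixes f :: "'a::{real_inner, complete_space} \<Rightarrow> real"
    and df :: "'a \<Rightarrow> 'a"
    and g :: "'a \<Rightarrow> ereal"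
    and P :: "'a \<Rightarrow> 'a"
    and Df :: "'a \<Rightarrow> 'a \<Rightarrow> real"
    and u :: "nat \<Rightarrow> 'a"
  assumes "convex_on UNIV f"
    and "\<And>x. GDERIV f x :> df x"
    and "\<exists>L. L-lipschitz_on UNIV df"
    and "proper g" and "ereal_convex g" and "lower_semicontinuous g"
    and "coercive (objective f g)"
    and "bounded_linear P" and "self_adjoint P" and "positive_semidefinite P"
    and "strongly_coercive (\<lambda>x. ereal (1/2 * norm_sq_wrt P x) + g x)"
    and "\<And>x y. Df x y \<ge> f y - f x - df x \<bullet> (y - x)"
    and "\<And>x y t. t \<in> {0..1} \<Longrightarrow> Df x (x + t *\<^sub>R (y - x)) \<le> t\<^sup>2 * Df x y"
    and "\<And>B :: ('a \<times> 'a) set. bounded B \<Longrightarrow> bounded ((\<lambda>(x, y). Df x y) ` B)"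
    and "hpgcg_sequence df g P Df u"
  shows "decseq (\<lambda>k. residual f g (u k)) \<and>
         (\<lambda>k. residual f g (u k)) \<longlonglongrightarrow> 0 \<and>
         (\<lambda>k. ereal (real k powr (1/3)) * residual f g (u k)) \<longlonglongrightarrow> 0"

proof -
  let ?S = "effective_domain g" and ?G = "\<lambda>x. real_of_ereal (g x)"
  obtain v where u0: "u 0 \<in> ?S"
    and v: "\<And>k. is_arg_min (subproblem df g P (u k)) (\<lambda>_. True) (v k)"
    and u_Suc: "\<And>k. u (Suc k) = u k + step_size df g P Df (u k) (v k) *\<^sub>R (v k - u k)"
    using assms(15) unfolding hpgcg_sequence_def by blast
  have above: "f x + df x \<bullet> (y - x) \<le> f y" for x y
    by (rule convex_above_gradient[OF assms(1,2)])
  have g_real: "g w = ereal (?G w)" if "w \<in> ?S" for w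
    by (rule proper_real_on_domain[OF assms(4) that])
  have v_in: "v k \<in> ?S" for k
    by (rule minimizer_in_domain[OF assms(4) v])
  have sub: "subproblem df g P x w
      = ereal (df x \<bullet> w - x \<bullet> P w + 1/2 * norm_sq_wrt P w + ?G w)" if "w \<in> ?S" for x w
    unfolding subproblem_def inner_wrt_def by (subst g_real[OF that]) simp
  have v_min: "df (u k) \<bullet> v k - u k \<bullet> P (v k) + 1/2 * norm_sq_wrt P (v k) + ?G (v k)
      \<le> df (u k) \<bullet> w - u k \<bullet> P w + 1/2 * norm_sq_wrt P w + ?G w" if "w \<in> ?S" for k w
  proof -
    have "subproblem df g P (u k) (v k) \<le> subproblem df g P (u k) w"
      using v[of k] by (auto simp: is_arg_min_linorder)
    then show ?thesis unfolding sub[OF v_in] sub[OF that] by simp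
  qed
  obtain L where L: "L-lipschitz_on UNIV df"
    using assms(3) by blast
  interpret hpgcg_iteration f df ?G ?S P Df u v "\<lambda>k. step_size df g P Df (u k) (v k)"
  proof (rule hpgcg_iteration.intro)
    show "convex_on ?S ?G"
      by (rule ereal_convex_imp_convex_on_domain[OF assms(4,5)])
    show "bounded {w \<in> ?S. f w + ?G w \<le> c}" for c
    proof (rule bounded_subset[OF coercive_sublevel_bounded[OF assms(7), of c]])
      show "{w \<in> ?S. f w + ?G w \<le> c} \<subseteq> {w. objective f g w \<le> ereal c}"
      proof clarify
        fix w assume "w \<in> ?S" "f w + ?G w \<le> c"
        then show "objective f g w \<le> ereal c"
          unfolding objective_def by (subst g_real) auto
      qed
    qed
    show "\<exists>R. \<forall>x\<in>?S. R \<le> norm x \<longrightarrow> M * norm x \<le> 1/2 * norm_sq_wrt P x + ?G x" for M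
    proof -
      obtain R where R: "\<And>x. R \<le> norm x \<Longrightarrow>
          ereal (M * norm x) \<le> ereal (1/2 * norm_sq_wrt P x) + g x"
        using strongly_coercive_above_linear[OF assms(11), of M] by blast
      have "M * norm x \<le> 1/2 * norm_sq_wrt P x + ?G x" if "x \<in> ?S" "R \<le> norm x" for x
        using R[OF that(2)] by (subst (asm) g_real[OF that(1)]) simp
      then show ?thesis by blast
    qed
    show "bounded (df ` A)" if "bounded A" for A
      by (rule lipschitz_on_bounded_image[OF L that])
    show "step_size df g P Df (u k) (v k) = (if Df (u k) (v k) = 0 then 1
      else min 1 ((df (u k) \<bullet> (u k - v k) + ?G (u k) - ?G (v k)) / (2 * Df (u k) (v k))))"
      if "u k \<in> ?S" for k
      by (rule step_size_eq[OF assms(4,8,9) that v_in v])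
  qed (fact above assms(12-14) assms(8-10) u0 v_in v_min u_Suc)+
  have inf: "(INF w. objective f g w) = ereal obj_inf"
    using INF_objective[OF assms(4), of f] obj_bdd_below by (simp add: obj_inf_def obj_def)
  have residual: "residual f g (u k) = ereal (res k)" for k
    unfolding residual_def inf objective_def res_def obj_def
    by (subst g_real[OF u_in]) simp
  have "decseq (\<lambda>k. residual f g (u k))"
    using decseq_res by (simp add: residual decseq_def)
  moreover have "(\<lambda>k. residual f g (u k)) \<longlonglongrightarrow> 0"
    using res_tendsto_0 by (simp add: residual zero_ereal_def)
  moreover have "(\<lambda>k. ereal (real k powr (1/3)) * residual f g (u k)) \<longlonglongrightarrow> 0"
    using res_rate by (simp add: residual zero_ereal_def)
  ultimately show ?thesis by blast
qed

end
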